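(* Let $q\ge2$ be an integer, $\theta_0=0$, $(\theta_1,\cdots,\theta_{q-1})\in\{0,1\}^{q-1}\setminus\{0^{q-1}\}$, let $(\theta_n)_{n\ge0}$ be the $(0,\theta_1,\cdots,\theta_{q-1})$-Thue-Morse sequence and $\delta_n:=(-1)^{\theta_n}$. For $a,b\in\mathbb{C}\setminus\{-1,-2,-3,\cdots\}$ put $$f(a,b):=\prod_{n=1}^\infty\Big(\frac{n+a}{n+b}\Big)^{\delta_n}.$$ Then for all $a,b\in\mathbb{C}\setminus\{-1,-2,-3,\cdots\}$, $$f(a,b)=\Big(\frac{a+1}{b+1}\Big)^{\delta_1}\cdots\Big(\frac{a+q-1}{b+q-1}\Big)^{\delta_{q-1}}f\Big(\frac{a}{q},\frac{b}{q}\Big)\Big(f\big(\tfrac{a+1}{q},\tfrac{b+1}{q}\big)\Big)^{\delta_1}\cdots\Big(f\big(\tfrac{a+q-1}{q},\tfrac{b+q-1}{q}\big)\Big)^{\delta_{q-1}},$$ which is equivalent to $$\prod_{n=1}^\infty\Big(\frac{n+a}{n+b}\cdot\frac{qn+b}{qn+a}\big(\frac{qn+b+1}{qn+a+1}\big)^{\delta_1}\cdots\big(\frac{qn+b+q-1}{qn+a+q-1}\big)^{\delta_{q-1}}\Big)^{\delta_n}=\Big(\frac{a+1}{b+1}\Big)^{\delta_1}\cdots\Big(\frac{a+q-1}{b+q-1}\Big)^{\delta_{q-1}}.$$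
   Context: For an integer $q\ge2$ and $\theta_1,\dots,\theta_{q-1}\in\{0,1\}$, the $(0,\theta_1,\cdots,\theta_{q-1})$-Thue-Morse sequence $(\theta_n)_{n\ge0}$ is the unique fixed point of the morphism on $\{0,1\}$ given by $0\mapsto0\theta_1\cdots\theta_{q-1}$, $1\mapsto1\overline{\theta}_1\cdots\overline{\theta}_{q-1}$, beginning with $\theta_0:=0$, where $\overline{0}:=1$ and $\overline{1}:=0$. *)

theory Defs
  imports "HOL-Analysis.Analysis" "HOL-Library.Stream"
begin

text \<open>Letters are the natural numbers 0 and 1, so that the complement of \<open>t\<close> is \<open>1 - t\<close>.
  The list \<open>ts\<close> is the word \<open>\<theta>\<^sub>1 \<dots> \<theta>\<^sub>q\<^sub>-\<^sub>1\<close>; hence \<open>q = Suc (length ts)\<close>.\<close>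

definition tm_morphism :: "nat list \<Rightarrow> nat \<Rightarrow> nat list" where
  "tm_morphism ts x = (if x = 0 then 0 # ts else 1 # map (\<lambda>t. 1 - t) ts)"

text \<open>An infinite word is a stream; a morphism acts on it by concatenating the images of its letters.\<close>

definition is_thue_morse :: "nat list \<Rightarrow> nat stream \<Rightarrow> bool" where
  "is_thue_morse ts s \<longleftrightarrow>
     sset s \<subseteq> {0, 1} \<and> shd s = 0 \<and> flat (smap (tm_morphism ts) s) = s"

definition thue_morse :: "nat list \<Rightarrow> nat stream" where
  "thue_morse ts = (THE s. is_thue_morse ts s)"

definition tm_sign :: "nat list \<Rightarrow> nat \<Rightarrow> int" where
  "tm_sign ts n = (-1) ^ (thue_morse ts !! n)"

definition tm_factor :: "nat list \<Rightarrow> complex \<Rightarrow> complex \<Rightarrow> nat \<Rightarrow> complex" where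
  "tm_factor ts a b n = ((of_nat n + a) / (of_nat n + b)) powi tm_sign ts n"

text \<open>The shift by \<open>Suc\<close> makes the product start at \<open>n = 1\<close>.\<close>

definition tm_prod :: "nat list \<Rightarrow> complex \<Rightarrow> complex \<Rightarrow> complex" where
  "tm_prod ts a b = prodinf (\<lambda>n. tm_factor ts a b (Suc n))"


text \<open>The description in \<^const>\<open>thue_morse\<close> is proper: the fixed point exists and is unique.\<close>

lemma length_tm_morphism [simp]: "length (tm_morphism ts x) = Suc (length ts)"
  by (simp add: tm_morphism_def)

lemma snth_flat_tm_morphism:
  "flat (smap (tm_morphism ts) s) !! n =
     tm_morphism ts (s !! (n div Suc (length ts))) ! (n mod Suc (length ts))"
proof (induction n arbitrary: s rule: less_induct)
  case (less n)
  have ne: "\<forall>xs\<in>sset (smap (tm_morphism ts) s). xs \<noteq> []"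
    by (auto simp: stream.set_map tm_morphism_def)
  show ?case
  proof (cases "n < Suc (length ts)")
    case True
    then show ?thesis
      by (subst flat_snth[OF ne]) simp
  next
    case False
    let ?m = "n - Suc (length ts)"
    have "flat (smap (tm_morphism ts) s) !! n = flat (smap (tm_morphism ts) (stl s)) !! ?m"
      using False by (subst flat_snth[OF ne]) simp
    also have "\<dots> = tm_morphism ts (stl s !! (?m div Suc (length ts))) ! (?m mod Suc (length ts))"
      using False by (intro less.IH) simp
    also have "stl s !! (?m div Suc (length ts)) = s !! Suc (?m div Suc (length ts))"
      by simp
    also have "Suc (?m div Suc (length ts)) = n div Suc (length ts)"
      using False by (simp add: le_div_geq)
    also have "?m mod Suc (length ts) = n mod Suc (length ts)"
      using False by (simp add: le_mod_geq)
    finally show ?thesis .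
  qed
qed

fun tm_aux :: "nat list \<Rightarrow> nat \<Rightarrow> nat" where
  "tm_aux ts n = (if n = 0 \<or> ts = [] then 0
     else tm_morphism ts (tm_aux ts (n div Suc (length ts))) ! (n mod Suc (length ts)))"

declare tm_aux.simps [simp del]

lemma set_tm_morphism: "set ts \<subseteq> {0, 1} \<Longrightarrow> set (tm_morphism ts x) \<subseteq> {0, 1}"
  by (auto simp: tm_morphism_def)

lemma tm_morphism_nth_in:
  assumes "set ts \<subseteq> {0, 1}"
  shows "tm_morphism ts x ! (n mod Suc (length ts)) \<in> {0, 1}"
  using set_tm_morphism[OF assms, of x] nth_mem[of "n mod Suc (length ts)" "tm_morphism ts x"]
  by (auto simp del: nth_mem)

lemma ex1_thue_morse:
  assumes "ts \<noteq> []" "set ts \<subseteq> {0, 1}"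
  shows "\<exists>!s. is_thue_morse ts s"
proof (rule ex_ex1I)
  let ?s = "smap (tm_aux ts) nats"
  have snth: "?s !! n = tm_aux ts n" for n
    by (simp add: snth_smap)
  have "tm_aux ts n \<in> {0, 1}" for n
    using tm_morphism_nth_in[OF assms(2)] by (subst tm_aux.simps) auto
  then have "sset ?s \<subseteq> {0, 1}"
    unfolding stream.set_map by (intro image_subsetI)
  moreover have "shd ?s = 0"
    by (simp add: tm_aux.simps)
  moreover have "flat (smap (tm_morphism ts) ?s) = ?s"
  proof -
    have "flat (smap (tm_morphism ts) ?s) !! n = ?s !! n" for n
    proof (cases "n = 0")
      case True
      then show ?thesis
        by (simp add: tm_aux.simps tm_morphism_def)
    next
      case False
      then show ?thesis
        using assms(1) by (simp only: snth_flat_tm_morphism snth tm_aux.simps[of ts n]) simp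
    qed
    then show ?thesis
      by (metis smap_alt stream.map_id)
  qed
  ultimately show "\<exists>s. is_thue_morse ts s"
    unfolding is_thue_morse_def by blast
next
  fix s t assume s: "is_thue_morse ts s" and t: "is_thue_morse ts t"
  have "s !! n = t !! n" for n
  proof (induction n rule: less_induct)
    case (less n)
    show ?case
    proof (cases "n = 0")
      case True
      then show ?thesis
        using s t by (simp add: is_thue_morse_def)
    next
      case False
      then have "n div Suc (length ts) < n"
        using assms(1) by simp
      then show ?thesis
        using less.IH snth_flat_tm_morphism[of ts s n] snth_flat_tm_morphism[of ts t n] s t
        by (simp add: is_thue_morse_def)
    qed
  qed
  then show "s = t"
    by (metis smap_alt stream.map_id)
qed

lemma is_thue_morse_thue_morse:
  assumes "ts \<noteq> []" "set ts \<subseteq> {0, 1}"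
  shows "is_thue_morse ts (thue_morse ts)"
  unfolding thue_morse_def by (rule theI') (rule ex1_thue_morse[OF assms])

end

theory Submission
  imports Defs
begin

text \<open>The signs satisfy \<open>\<delta>(m q + i) = \<delta>(m) \<delta>(i)\<close> for \<open>i < q\<close>. Once the product
  \<open>f(a, b)\<close> is known to converge, the functional equation follows by grouping the factors into
  blocks \<open>m q, \<dots>, m q + q - 1\<close> and letting the number of blocks tend to infinity.

  For convergence, take logarithms: \<open>Ln ((n + a) / (n + b)) = (a - b) / n + O(1 / n\<^sup>2)\<close>, so it
  suffices that \<open>\<Sum> \<delta>(n) / n\<close> converges. The partial sums \<open>D\<close> of \<open>\<delta>\<close> satisfy
  \<open>D(m q + r) = D(m) D(q) + \<delta>(m) D(r)\<close> with \<open>\<bar>D(q)\<bar> < q\<close>, because \<open>\<delta>(0) = 1\<close> and some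
  \<open>\<delta>(i) = -1\<close>. This contraction gives both \<open>D(n) = o(n)\<close> and \<open>\<Sum> \<bar>D(n)\<bar> / n\<^sup>2 < \<infinity>\<close>,
  and summation by parts concludes.\<close>

section \<open>Partial sums of \<open>q\<close>-multiplicative sequences\<close>

lemma sum_atLeastLessThan_add:
  fixes f :: "nat \<Rightarrow> 'a::comm_monoid_add"
  shows "sum f {k..<k + r} = (\<Sum>i<r. f (k + i))"
  by (induction r) (simp_all add: atLeastLessThanSuc add.commute)

lemma prod_atLeastLessThan_add:
  fixes f :: "nat \<Rightarrow> 'a::comm_monoid_mult"
  shows "prod f {k..<k + r} = (\<Prod>i<r. f (k + i))"
  by (induction r) (simp_all add: atLeastLessThanSuc mult.commute)

text \<open>These three properties of the signs drive the convergence proof. The strict bound on one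
  block makes the recursion for the partial sums a contraction; it excludes \<open>d\<close>
  constantly 1, which would lead to the harmonic series.\<close>

locale q_multiplicative =
  fixes q :: nat and d :: "nat \<Rightarrow> real"
  assumes mult: "i < q \<Longrightarrow> d (m * q + i) = d m * d i"
    and abs_le_1: "\<bar>d n\<bar> \<le> 1"
    and abs_block_less: "\<bar>\<Sum>i<q. d i\<bar> < real q"
begin

definition D :: "nat \<Rightarrow> real" where "D n = sum d {..<n}"

lemma q_pos: "q > 0"
  using abs_block_less by (cases q) auto

lemma abs_D_le: "\<bar>D n\<bar> \<le> real n"
  unfolding D_def using sum_norm_le[of "{..<n}" d "\<lambda>_. 1"] abs_le_1 by simp

text \<open>Cut the range at the multiples of \<open>q\<close>: by multiplicativity the piece
  starting at \<open>j * q\<close> is \<open>d j\<close> times the initial piece of the same length.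
  The local fact \<open>block\<close> serves the full blocks, with \<open>q\<close> for
  \<open>r\<close>, and the remainder.\<close>

lemma D_split:
  assumes "r \<le> q"
  shows "D (m * q + r) = D m * D q + d m * D r"
proof -
  have block: "sum d {j * q..<j * q + r} = d j * D r" if "r \<le> q" for j r
    using that by (simp add: sum_atLeastLessThan_add D_def sum_distrib_left mult)
  have "D (m * q + r) = sum d {..<m * q} + sum d {m * q..<m * q + r}"
    unfolding D_def by (simp flip: sum.atLeastLessThan_concat[of 0 "m * q" "m * q + r"] add: lessThan_atLeast0)
  also have "sum d {..<m * q} = D m * D q"
    by (simp flip: sum.nat_group add: block sum_distrib_right) (simp add: D_def sum_distrib_right)
  finally show ?thesis
    using block[OF assms] by simp
qed

lemma abs_D_split_le:
  assumes "r \<le> q"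
  shows "\<bar>D (m * q + r)\<bar> \<le> \<bar>D q\<bar> * \<bar>D m\<bar> + real q"
proof -
  have "\<bar>d m * D r\<bar> \<le> 1 * real q"
    unfolding abs_mult using abs_D_le[of r] assms abs_le_1[of m] by (intro mult_mono) auto
  then show ?thesis
    unfolding D_split[OF assms] using abs_triangle_ineq[of "D m * D q" "d m * D r"]
    by (simp add: abs_mult mult.commute)
qed

lemma D_ratio: "\<bar>D q\<bar> / real q \<ge> 0" "\<bar>D q\<bar> / real q < 1"
  using abs_block_less q_pos by (simp_all add: D_def)

text \<open>Each division of \<open>n\<close> by \<open>q\<close> multiplies the slope by
  \<open>\<bar>D q\<bar> / real q\<close>, which is less than 1, and changes only the constant,
  which may depend on \<open>k\<close> but not on \<open>n\<close>.\<close>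

lemma abs_D_le_power: "\<exists>C. \<forall>n. \<bar>D n\<bar> \<le> (\<bar>D q\<bar> / real q) ^ k * real n + C"
proof (induction k)
  case 0
  show ?case
    using abs_D_le by (intro exI[of _ 0]) simp
next
  case (Suc k)
  then obtain C where C: "\<And>n. \<bar>D n\<bar> \<le> (\<bar>D q\<bar> / real q) ^ k * real n + C"
    by blast
  show ?case
  proof (intro exI allI)
    fix n
    let ?m = "n div q"
    have "\<bar>D n\<bar> \<le> \<bar>D q\<bar> * \<bar>D ?m\<bar> + real q"
      using abs_D_split_le[of "n mod q" ?m] q_pos by simp
    also have "\<dots> \<le> \<bar>D q\<bar> * ((\<bar>D q\<bar> / real q) ^ k * real ?m + C) + real q"
      using C by (intro add_right_mono mult_left_mono) auto
    also have "\<dots> \<le> \<bar>D q\<bar> * ((\<bar>D q\<bar> / real q) ^ k * (real n / real q) + C) + real q"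
      using of_nat_div_le_of_nat[of n q] by (intro add_right_mono mult_left_mono add_mono) auto
    also have "\<dots> = (\<bar>D q\<bar> / real q) ^ Suc k * real n + (\<bar>D q\<bar> * C + real q)"
      by (simp add: algebra_simps)
    finally show "\<bar>D n\<bar> \<le> (\<bar>D q\<bar> / real q) ^ Suc k * real n + (\<bar>D q\<bar> * C + real q)" .
  qed
qed

lemma D_over_n_tendsto: "(\<lambda>n. D n / real n) \<longlonglongrightarrow> 0"
proof (rule LIMSEQ_I)
  fix e :: real assume "e > 0"
  \<comment> \<open>\<open>k\<close> brings the slope below \<open>e / 2\<close>; beyond the later
    \<open>N\<close> the constant is below \<open>e / 2 * real n\<close> too.\<close>
  then obtain k where k: "(\<bar>D q\<bar> / real q) ^ k < e / 2"
    using D_ratio real_arch_pow_inv[of "e / 2" "\<bar>D q\<bar> / real q"] by auto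
  obtain C where C: "\<And>n. \<bar>D n\<bar> \<le> (\<bar>D q\<bar> / real q) ^ k * real n + C"
    using abs_D_le_power by blast
  obtain N :: nat where N: "2 * \<bar>C\<bar> / e < real N"
    using reals_Archimedean2 by blast
  show "\<exists>N. \<forall>n\<ge>N. norm (D n / real n - 0) < e"
  proof (intro exI allI impI)
    fix n assume n: "n \<ge> Suc N"
    have "\<bar>D n\<bar> \<le> (\<bar>D q\<bar> / real q) ^ k * real n + C"
      by (rule C)
    also have "\<dots> < e / 2 * real n + e / 2 * real n"
    proof (rule add_strict_mono)
      show "(\<bar>D q\<bar> / real q) ^ k * real n < e / 2 * real n"
        using k n by (intro mult_strict_right_mono) auto
      have "2 * \<bar>C\<bar> / e < real n"
        using N n by simp
      then show "C < e / 2 * real n"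
        using \<open>e > 0\<close> by (simp add: field_simps)
    qed
    finally show "norm (D n / real n - 0) < e"
      using n by (simp add: field_simps)
  qed
qed

text \<open>For \<open>m > 0\<close> the \<open>q\<close> denominators in block \<open>m\<close> are
  at least \<open>(m * q)^2\<close>, so the block contributes at most \<open>?c\<close> times the
  term of index \<open>m\<close>, plus \<open>1 / m^2\<close>. Hence
  \<open>S K \<le> S (K * q) \<le> ?c * S K + suminf g\<close>, and \<open>?c < 1\<close> bounds the
  partial sums.\<close>

lemma summable_D_over_square: "summable (\<lambda>n. \<bar>D n\<bar> / real n ^ 2)"
proof -
  define S where "S K = (\<Sum>n<K. \<bar>D n\<bar> / real n ^ 2)" for K
  \<comment> \<open>The block \<open>m = 0\<close> is treated apart: there the division by \<open>m\<^sup>2\<close> yields the junk value 0.\<close>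
  define g where "g m = inverse (real m ^ 2) + (if m = 0 then S q else 0)" for m
  have "summable g"
    unfolding g_def by (intro summable_add inverse_power_summable) auto
  have g_nonneg: "g m \<ge> 0" for m
    unfolding g_def S_def by (auto intro!: add_nonneg_nonneg sum_nonneg)
  let ?c = "\<bar>D q\<bar> / real q"
  have block: "(\<Sum>i<q. \<bar>D (m * q + i)\<bar> / real (m * q + i) ^ 2) \<le> ?c * (\<bar>D m\<bar> / real m ^ 2) + g m" for m
  proof (cases "m = 0")
    case True
    then show ?thesis by (simp add: g_def S_def)
  next
    case False
    have "(\<Sum>i<q. \<bar>D (m * q + i)\<bar> / real (m * q + i) ^ 2)
        \<le> (\<Sum>i<q. (\<bar>D q\<bar> * \<bar>D m\<bar> + real q) / real (m * q) ^ 2)"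
      using False q_pos abs_D_split_le by (intro sum_mono frac_le power_mono) auto
    also have "\<dots> = ?c * (\<bar>D m\<bar> / real m ^ 2) + g m"
      using False q_pos by (simp add: g_def field_simps power2_eq_square)
    finally show ?thesis .
  qed
  have "S K \<le> suminf g / (1 - ?c)" for K
  proof -
    have "S K \<le> S (K * q)"
      unfolding S_def using q_pos by (intro sum_mono2) auto
    also have "S (K * q) = (\<Sum>m<K. \<Sum>i<q. \<bar>D (m * q + i)\<bar> / real (m * q + i) ^ 2)"
      unfolding S_def sum.nat_group[symmetric] sum_atLeastLessThan_add ..
    also have "\<dots> \<le> (\<Sum>m<K. ?c * (\<bar>D m\<bar> / real m ^ 2) + g m)"
      by (intro sum_mono block)
    also have "\<dots> = ?c * S K + sum g {..<K}"
      by (simp only: sum.distrib S_def sum_distrib_left)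
    also have "sum g {..<K} \<le> suminf g"
      using \<open>summable g\<close> g_nonneg by (intro sum_le_suminf) auto
    finally have "(1 - ?c) * S K \<le> suminf g"
      by (simp add: algebra_simps)
    then show ?thesis
      using D_ratio by (simp add: pos_le_divide_eq mult.commute)
  qed
  then have "(\<Sum>n\<le>K. \<bar>D n\<bar> / real n ^ 2) \<le> suminf g / (1 - ?c)" for K
    unfolding S_def lessThan_Suc_atMost[symmetric] .
  then show ?thesis
    by (intro bounded_imp_summable) auto
qed

lemma summable_over_n: "summable (\<lambda>n. d n / real n)"
proof -
  \<comment> \<open>Summation by parts: \<open>u\<close> is the boundary term.\<close>
  define u where "u n = D (Suc n) / real (Suc n)" for n
  have "u \<longlonglongrightarrow> 0"
    unfolding u_def using D_over_n_tendsto by (rule LIMSEQ_Suc)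
  then have "summable (\<lambda>n. u (Suc n) - u n)"
    by (rule telescope_summable)
  moreover have "summable (\<lambda>n. D (Suc (Suc n)) / (real (Suc n) * real (Suc (Suc n))))"
  proof (rule summable_comparison_test')
    \<comment> \<open>The factor 2 pays for replacing \<open>n + 1\<close> by \<open>n + 2\<close>
      in the denominator, as \<open>n + 2 \<le> 2 * (n + 1)\<close>.\<close>
    show "summable (\<lambda>n. 2 * (\<bar>D (Suc (Suc n))\<bar> / real (Suc (Suc n)) ^ 2))"
      using summable_D_over_square
      by (intro summable_mult) (subst summable_Suc_iff, subst summable_Suc_iff)
    show "norm (D (Suc (Suc n)) / (real (Suc n) * real (Suc (Suc n))))
        \<le> 2 * (\<bar>D (Suc (Suc n))\<bar> / real (Suc (Suc n)) ^ 2)" for n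
    proof -
      have "\<bar>D (Suc (Suc n))\<bar> * real (Suc (Suc n)) \<le> \<bar>D (Suc (Suc n))\<bar> * (2 * real (Suc n))"
        by (intro mult_left_mono) auto
      then show ?thesis
        by (simp add: divide_simps abs_mult power2_eq_square) (simp add: algebra_simps)
    qed
  qed
  ultimately have "summable (\<lambda>n. (u (Suc n) - u n) + D (Suc (Suc n)) / (real (Suc n) * real (Suc (Suc n))))"
    by (rule summable_add)
  moreover have "(u (Suc n) - u n) + D (Suc (Suc n)) / (real (Suc n) * real (Suc (Suc n)))
      = d (Suc n) / real (Suc n)" for n
  proof -
    have "D (Suc (Suc n)) = D (Suc n) + d (Suc n)"
      by (simp add: D_def)
    then show ?thesis
      unfolding u_def by (simp add: divide_simps) (simp add: algebra_simps)
  qed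
  ultimately show ?thesis
    by (subst summable_Suc_iff[symmetric]) simp
qed

end

section \<open>Logarithms of the ratios\<close>

text \<open>The ratio is \<open>1 + z\<close> with \<open>z = (a - b) / (n + b)\<close>. Both
  \<open>Ln (1 + z) - z\<close> and \<open>z - (a - b) / n\<close> are of order
  \<open>1 / n^2\<close>. Degenerate ratios occur only for small \<open>n\<close> and do not affect
  summability.\<close>

lemma summable_Ln_ratio_remainder:
  fixes a b :: complex
  shows "summable (\<lambda>n. norm (Ln ((of_nat n + a) / (of_nat n + b)) - (a - b) / of_nat n))"
proof -
  \<comment> \<open>The first summand of \<open>C\<close> bounds \<open>Ln (1 + z) - z\<close>, the
    second bounds \<open>z - (a - b) / n\<close>.\<close>
  define C where "C = 8 * norm (a - b) ^ 2 + 2 * norm (a - b) * norm b"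
  \<comment> \<open>Beyond \<open>N\<close>, the summand \<open>2 * norm b\<close> yields
    \<open>norm (n + b) \<ge> n / 2\<close>, and \<open>4 * norm (a - b)\<close> then yields
    \<open>norm z \<le> 1 / 2\<close>.\<close>
  obtain N :: nat where N: "2 * norm b + 4 * norm (a - b) + 1 < real N"
    using reals_Archimedean2 by blast
  show ?thesis
  proof (rule summable_comparison_test')
    show "summable (\<lambda>n. C * inverse (real n ^ 2))"
      by (intro summable_mult inverse_power_summable) auto
    fix n assume "n \<ge> N"
    then have n: "2 * norm b + 4 * norm (a - b) + 1 < real n"
      using N by simp
    then have n0: "real n > 0"
      using norm_ge_zero[of b] norm_ge_zero[of "a - b"] by linarith
    define z where "z = (a - b) / (of_nat n + b)"
    have "real n \<le> norm (of_nat n + b) + norm b"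
      using norm_triangle_ineq4[of "of_nat n + b" b] by simp
    then have nb: "norm (of_nat n + b) \<ge> real n / 2"
      using n norm_ge_zero[of "a - b"] by linarith
    then have nz: "of_nat n + b \<noteq> 0"
      using n0 by auto
    have "norm z \<le> norm (a - b) / (real n / 2)"
      unfolding z_def norm_divide using nb n0 nz by (intro divide_left_mono mult_pos_pos) auto
    then have z: "norm z \<le> 2 * norm (a - b) / real n"
      by (simp add: field_simps)
    moreover have "4 * norm (a - b) \<le> real n"
      using n norm_ge_zero[of b] by linarith
    then have "2 * norm (a - b) / real n \<le> 1 / 2"
      using n0 by (simp add: field_simps)
    ultimately have z_half: "norm z \<le> 1 / 2"
      by linarith
    have "norm (Ln (1 + z) - z) \<le> norm z ^ 2 / (1 - norm z)"
      using z_half by (intro Ln_approx_linear) auto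
    also have "\<dots> \<le> norm z ^ 2 / (1 / 2)"
      using z_half by (intro divide_left_mono) auto
    also have "\<dots> \<le> (2 * norm (a - b) / real n) ^ 2 / (1 / 2)"
      using z by (intro divide_right_mono power_mono) auto
    finally have 1: "norm (Ln (1 + z) - z) \<le> 8 * norm (a - b) ^ 2 / real n ^ 2"
      by (simp add: power_divide power_mult_distrib)
    have "z - (a - b) / of_nat n = - ((a - b) * b) / (of_nat n * (of_nat n + b))"
      unfolding z_def using n0 nz by (simp add: field_simps)
    then have "norm (z - (a - b) / of_nat n) = norm (a - b) * norm b / (real n * norm (of_nat n + b))"
      by (simp add: norm_mult norm_divide)
    also have "\<dots> \<le> norm (a - b) * norm b / (real n * (real n / 2))"
      using nb n0 nz by (intro divide_left_mono mult_left_mono mult_pos_pos) auto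
    finally have 2: "norm (z - (a - b) / of_nat n) \<le> 2 * norm (a - b) * norm b / real n ^ 2"
      by (simp add: power2_eq_square mult.commute mult.left_commute)
    have "(of_nat n + a) / (of_nat n + b) = 1 + z"
      unfolding z_def using nz by (simp add: field_simps)
    then have "norm (Ln ((of_nat n + a) / (of_nat n + b)) - (a - b) / of_nat n)
        \<le> norm (Ln (1 + z) - z) + norm (z - (a - b) / of_nat n)"
      using norm_triangle_ineq[of "Ln (1 + z) - z" "z - (a - b) / of_nat n"] by simp
    also have "\<dots> \<le> C * inverse (real n ^ 2)"
      using add_mono[OF 1 2] by (simp add: C_def divide_inverse distrib_right)
    finally show "norm (norm (Ln ((of_nat n + a) / (of_nat n + b)) - (a - b) / of_nat n))
        \<le> C * inverse (real n ^ 2)"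
      by simp
  qed
qed

text \<open>The remainder converges absolutely; the main term \<open>(a - b) * d n / n\<close>
  converges by the cancellation in \<open>d\<close>.\<close>

lemma (in q_multiplicative) summable_Ln_ratio:
  fixes a b :: complex
  shows "summable (\<lambda>n. of_real (d n) * Ln ((of_nat n + a) / (of_nat n + b)))"
proof -
  let ?r = "\<lambda>n. Ln ((of_nat n + a) / (of_nat n + b)) - (a - b) / of_nat n"
  have "summable (\<lambda>n. of_real (d n) * ?r n)"
  proof (rule summable_comparison_test'[OF summable_Ln_ratio_remainder[of a b]])
    show "norm (of_real (d n) * ?r n) \<le> norm (?r n)" for n
      using mult_right_mono[OF abs_le_1[of n] norm_ge_zero[of "?r n"]] by (simp add: norm_mult)
  qed
  moreover have "summable (\<lambda>n. (a - b) * of_real (d n / real n))"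
    by (intro summable_mult summable_of_real summable_over_n)
  ultimately have "summable (\<lambda>n. of_real (d n) * ?r n + (a - b) * of_real (d n / real n))"
    by (rule summable_add)
  then show ?thesis
    by (simp add: algebra_simps)
qed

section \<open>Signs of the Thue-Morse word\<close>

lemma thue_morse_snth_mem:
  assumes "ts \<noteq> []" "set ts \<subseteq> {0, 1}"
  shows "thue_morse ts !! n \<in> {0, 1}"
  using is_thue_morse_thue_morse[OF assms] snth_sset[of "thue_morse ts" n]
  unfolding is_thue_morse_def by blast

lemma thue_morse_snth:
  assumes "ts \<noteq> []" "set ts \<subseteq> {0, 1}"
  shows "thue_morse ts !! n =
    tm_morphism ts (thue_morse ts !! (n div Suc (length ts))) ! (n mod Suc (length ts))"
  using is_thue_morse_thue_morse[OF assms] snth_flat_tm_morphism[of ts "thue_morse ts" n]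
  unfolding is_thue_morse_def by simp

text \<open>The word starts with the letter 0, hence with the image of 0 under the morphism.\<close>

lemma thue_morse_snth_initial:
  assumes "ts \<noteq> []" "set ts \<subseteq> {0, 1}" "i < Suc (length ts)"
  shows "thue_morse ts !! i = (0 # ts) ! i"
  using thue_morse_snth[OF assms(1,2), of i] is_thue_morse_thue_morse[OF assms(1,2)] assms(3)
  by (simp add: is_thue_morse_def tm_morphism_def)

lemma tm_sign_cases:
  assumes "ts \<noteq> []" "set ts \<subseteq> {0, 1}"
  shows "tm_sign ts n = 1 \<or> tm_sign ts n = -1"
  using thue_morse_snth_mem[OF assms, of n] by (auto simp: tm_sign_def)

lemma tm_sign_0:
  assumes "ts \<noteq> []" "set ts \<subseteq> {0, 1}"
  shows "tm_sign ts 0 = 1"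
  using thue_morse_snth_initial[OF assms, of 0] by (simp add: tm_sign_def)

text \<open>The letter at \<open>m q + i\<close> is the \<open>i\<close>-th letter of the image of
  letter \<open>m\<close>: letter \<open>i\<close> itself or its complement, and complementing flips
  the sign.\<close>

lemma tm_sign_mult:
  assumes "ts \<noteq> []" "set ts \<subseteq> {0, 1}" and i: "i < Suc (length ts)"
  shows "tm_sign ts (m * Suc (length ts) + i) = tm_sign ts m * tm_sign ts i"
proof -
  have "(m * Suc (length ts) + i) div Suc (length ts) = m"
    using i by (subst div_mult_self3) auto
  moreover have "(m * Suc (length ts) + i) mod Suc (length ts) = i"
    using i by (subst mod_mult_self3) auto
  ultimately have "thue_morse ts !! (m * Suc (length ts) + i) = tm_morphism ts (thue_morse ts !! m) ! i"
    using thue_morse_snth[OF assms(1,2), of "m * Suc (length ts) + i"] by simp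
  \<comment> \<open>For \<open>i = 0\<close> this uses that the image of 1 begins with 1, the
    complement of the initial letter.\<close>
  also have "\<dots> = (if thue_morse ts !! m = 0 then thue_morse ts !! i else 1 - thue_morse ts !! i)"
    unfolding thue_morse_snth_initial[OF assms] using i by (cases i) (auto simp: tm_morphism_def)
  finally show ?thesis
    using thue_morse_snth_mem[OF assms(1,2), of m] thue_morse_snth_mem[OF assms(1,2), of i]
    unfolding tm_sign_def by auto
qed

lemma q_multiplicative_tm_sign:
  assumes "ts \<noteq> []" "set ts \<subseteq> {0, 1}" "ts \<noteq> replicate (length ts) 0"
  shows "q_multiplicative (Suc (length ts)) (\<lambda>n. of_int (tm_sign ts n))"
proof
  let ?d = "\<lambda>n. of_int (tm_sign ts n) :: real" and ?q = "Suc (length ts)"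
  show "?d (m * ?q + i) = ?d m * ?d i" if "i < ?q" for i m
    using tm_sign_mult[OF assms(1,2) that] by simp
  show abs: "\<bar>?d n\<bar> \<le> 1" for n
    using tm_sign_cases[OF assms(1,2), of n] by auto
  \<comment> \<open>A letter 1 in \<open>ts\<close> at position \<open>j\<close> is letter
    \<open>Suc j\<close> of the word, so its sign -1 cancels the sign 1 at index 0. The other
    \<open>q - 2\<close> signs sum to at most \<open>q - 2\<close> in absolute value.\<close>
  obtain t where "t \<in> set ts" "t \<noteq> 0"
    using assms(3) replicate_eqI[of ts "length ts" 0] by auto
  then obtain j where j: "j < length ts" "ts ! j = 1"
    using assms(2) by (metis in_set_conv_nth insert_iff singletonD subsetD)
  have j_sign: "?d (Suc j) = -1"
    using thue_morse_snth_initial[OF assms(1,2), of "Suc j"] j by (simp add: tm_sign_def)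
  have split: "(\<Sum>i<?q. ?d i) = ?d 0 + (?d (Suc j) + sum ?d ({..<?q} - {0, Suc j}))"
  proof -
    have "(\<Sum>i<?q. ?d i) = ?d 0 + sum ?d ({..<?q} - {0})"
      by (rule sum.remove) auto
    also have "sum ?d ({..<?q} - {0}) = ?d (Suc j) + sum ?d ({..<?q} - {0} - {Suc j})"
      using j by (intro sum.remove) auto
    also have "{..<?q} - {0} - {Suc j} = {..<?q} - {0, Suc j}"
      by auto
    finally show ?thesis .
  qed
  have "\<bar>sum ?d ({..<?q} - {0, Suc j})\<bar> \<le> real (card ({..<?q} - {0, Suc j}))"
    using sum_norm_le[of "{..<?q} - {0, Suc j}" ?d "\<lambda>_. 1"] abs by simp
  also have "card ({..<?q} - {0, Suc j}) = ?q - 2"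
    using j by (subst card_Diff_subset) auto
  finally show "\<bar>\<Sum>i<?q. ?d i\<bar> < real ?q"
    unfolding split j_sign tm_sign_0[OF assms(1,2)] by simp
qed

section \<open>Factors of the product and its convergence\<close>

lemma powi_sign_distrib:
  fixes x y :: complex
  assumes "e = 1 \<or> e = -1"
  shows "(x / y) powi e = x powi e / y powi e"
    and "(\<Prod>i\<in>A. f i :: complex) powi e = (\<Prod>i\<in>A. f i powi e)"
  using assms prod_inversef[of f A] by (auto simp: power_int_minus divide_inverse o_def)

lemma has_prod_powi_sign:
  fixes f :: "nat \<Rightarrow> complex"
  assumes "e = 1 \<or> e = -1" "f has_prod x"
  shows "(\<lambda>n. f n powi e) has_prod (x powi e)"
  using assms has_prod_inverse[of f x] by (auto simp: power_int_minus)

text \<open>The parameters at which some \<open>n + a\<close> with \<open>n \<ge> 1\<close>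
  vanishes.\<close>

definition neg_ints :: "complex set" where
  "neg_ints = {- of_nat k | k :: nat. k \<ge> 1}"

lemma of_nat_Suc_add_nonzero: "a \<notin> neg_ints \<Longrightarrow> of_nat (Suc n) + a \<noteq> 0"
proof
  assume "a \<notin> neg_ints" "of_nat (Suc n) + a = 0"
  then have "a = - of_nat (Suc n)"
    by (simp only: eq_neg_iff_add_eq_0 add.commute)
  with \<open>a \<notin> neg_ints\<close> show False
    unfolding neg_ints_def by fastforce
qed

text \<open>A value \<open>-k\<close> would force \<open>a = -(k q + i)\<close>. Thus all parameters
  on the right of the functional equation are admissible.\<close>

lemma divide_add_notin_neg_ints:
  assumes "a \<notin> neg_ints" "q > 0"
  shows "(a + of_nat i) / of_nat q \<notin> neg_ints"
proof
  assume "(a + of_nat i) / of_nat q \<in> neg_ints"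
  then obtain k :: nat where "k \<ge> 1" "(a + of_nat i) / of_nat q = - of_nat k"
    by (auto simp: neg_ints_def)
  then have "a = - of_nat (k * q + i)" "k * q + i \<ge> 1"
    using \<open>q > 0\<close> by (auto simp: field_simps eq_neg_iff_add_eq_0 Suc_le_eq)
  then show False
    using assms(1) unfolding neg_ints_def by blast
qed

lemma tm_factor_nonzero:
  assumes "a \<notin> neg_ints" "b \<notin> neg_ints"
  shows "tm_factor ts a b (Suc n) \<noteq> 0"
  unfolding tm_factor_def
  using of_nat_Suc_add_nonzero[OF assms(1), of n] of_nat_Suc_add_nonzero[OF assms(2), of n]
  by (simp add: power_int_eq_0_iff)

lemma convergent_tm_prod:
  assumes "ts \<noteq> []" "set ts \<subseteq> {0, 1}" "ts \<noteq> replicate (length ts) 0"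
    and "a \<notin> neg_ints" "b \<notin> neg_ints"
  shows "convergent_prod (\<lambda>n. tm_factor ts a b (Suc n))"
proof -
  let ?L = "\<lambda>n. of_real (of_int (tm_sign ts n)) * Ln ((of_nat n + a) / (of_nat n + b))"
  have "summable ?L"
    using q_multiplicative.summable_Ln_ratio[OF q_multiplicative_tm_sign[OF assms(1-3)]] .
  \<comment> \<open>The shift drops index 0, where the ratio \<open>a / b\<close> may be degenerate
    because 0 is an admissible parameter.\<close>
  then have "convergent_prod (\<lambda>n. exp (?L (Suc n)))"
    by (intro convergent_prod_exp) (subst summable_Suc_iff)
  moreover have "exp (?L (Suc n)) = tm_factor ts a b (Suc n)" for n
    using tm_sign_cases[OF assms(1,2), of "Suc n"]
      of_nat_Suc_add_nonzero[OF assms(4), of n] of_nat_Suc_add_nonzero[OF assms(5), of n]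
    by (auto simp: tm_factor_def exp_minus power_int_minus simp del: of_nat_Suc)
  ultimately show ?thesis
    by simp
qed

text \<open>Since \<open>m q + i + c = q (m + (c + i) / q)\<close>, the factor \<open>q\<close>
  cancels from the ratio, and the exponent splits by \<open>tm_sign_mult\<close>.\<close>

lemma tm_factor_mult:
  assumes "ts \<noteq> []" "set ts \<subseteq> {0, 1}" "q = Suc (length ts)" "i < q"
  shows "tm_factor ts a b (m * q + i) =
    tm_factor ts ((a + of_nat i) / of_nat q) ((b + of_nat i) / of_nat q) m powi tm_sign ts i"
proof -
  have q_pos: "q > 0"
    using assms(4) by simp
  have scale: "of_nat (m * q + i) + c = of_nat q * (of_nat m + (c + of_nat i) / of_nat q)" for c :: complex
    using q_pos by (simp add: field_simps)
  have "(of_nat (m * q + i) + a) / (of_nat (m * q + i) + b)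
      = (of_nat m + (a + of_nat i) / of_nat q) / (of_nat m + (b + of_nat i) / of_nat q)"
    unfolding scale using q_pos by (subst mult_divide_mult_cancel_left) auto
  then show ?thesis
    using tm_sign_mult[OF assms(1,2), of i m] assms(3,4)
    by (simp add: tm_factor_def power_int_mult)
qed

section \<open>The functional equation in both forms\<close>

theorem theorem1p2:
  fixes q :: nat and ts :: "nat list" and a b :: complex
  assumes "q \<ge> 2"
    and "length ts = q - 1" and "set ts \<subseteq> {0, 1}" and "ts \<noteq> replicate (q - 1) 0"
    and "a \<notin> {- of_nat k | k :: nat. k \<ge> 1}" and "b \<notin> {- of_nat k | k :: nat. k \<ge> 1}"
  shows "convergent_prod (\<lambda>n. tm_factor ts a b (Suc n))
    \<and> tm_prod ts a b =
        (\<Prod>i = 1..q - 1. ((a + of_nat i) / (b + of_nat i)) powi tm_sign ts i)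
        * tm_prod ts (a / of_nat q) (b / of_nat q)
        * (\<Prod>i = 1..q - 1.
            tm_prod ts ((a + of_nat i) / of_nat q) ((b + of_nat i) / of_nat q) powi tm_sign ts i)
    \<and> (\<lambda>m. let n = Suc m in
          ((of_nat n + a) / (of_nat n + b)
           * ((of_nat q * of_nat n + b) / (of_nat q * of_nat n + a))
           * (\<Prod>i = 1..q - 1.
               ((of_nat q * of_nat n + b + of_nat i) / (of_nat q * of_nat n + a + of_nat i))
                 powi tm_sign ts i)) powi tm_sign ts n)
        has_prod (\<Prod>i = 1..q - 1. ((a + of_nat i) / (b + of_nat i)) powi tm_sign ts i)"
proof -
  have q: "q = Suc (length ts)" "q > 0" and ts: "ts \<noteq> []" "ts \<noteq> replicate (length ts) 0"
    using assms(1,2,4) by auto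
  have a: "a \<notin> neg_ints" and b: "b \<notin> neg_ints"
    using assms(5,6) by (simp_all add: neg_ints_def)
  note sign = tm_sign_cases[OF ts(1) assms(3)]
  define A where "A i = (a + of_nat i) / of_nat q" for i
  define B where "B i = (b + of_nat i) / of_nat q" for i
  have AB: "A i \<notin> neg_ints" "B i \<notin> neg_ints" for i
    unfolding A_def B_def using a b q(2) by (simp_all only: divide_add_notin_neg_ints not_False_eq_True)
  have has_prod: "(\<lambda>n. tm_factor ts x y (Suc n)) has_prod tm_prod ts x y"
    if "x \<notin> neg_ints" "y \<notin> neg_ints" for x y
    unfolding tm_prod_def
    by (rule convergent_prod_has_prod[OF convergent_tm_prod[OF ts(1) assms(3) ts(2) that]])
  have nonzero: "tm_prod ts x y \<noteq> 0" if "x \<notin> neg_ints" "y \<notin> neg_ints" for x y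
    unfolding tm_prod_def
    by (rule prodinf_nonzero[OF convergent_tm_prod[OF ts(1) assms(3) ts(2) that] tm_factor_nonzero[OF that]])
  define E where "E = (\<Prod>i = 1..q - 1. ((a + of_nat i) / (b + of_nat i)) powi tm_sign ts i)"
  \<comment> \<open>As the sign at 0 is 1, \<open>R\<close> includes the product with parameters
    \<open>a / q\<close> and \<open>b / q\<close> as its term \<open>i = 0\<close>.\<close>
  define R where "R = (\<Prod>i<q. tm_prod ts (A i) (B i) powi tm_sign ts i)"
  let ?r = "\<lambda>n. \<Prod>i<q. tm_factor ts (A i) (B i) (Suc n) powi tm_sign ts i"
  have r: "?r has_prod R"
    unfolding R_def by (intro has_prod_prod has_prod_powi_sign sign has_prod AB)
  have R_nonzero: "R \<noteq> 0"
    unfolding R_def using nonzero[OF AB] by (simp add: power_int_eq_0_iff)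
  have split_0: "(\<Prod>i<q. h i) = h 0 * (\<Prod>i = 1..q - 1. h i)" for h :: "nat \<Rightarrow> complex"
  proof -
    have "{..<q} = insert 0 {1..q - 1}"
      using q(2) by auto
    then show ?thesis by simp
  qed
  \<comment> \<open>The indices run from 1 to \<open>(N + 1) q - 1\<close>. Block 0 lacks its index
    0 and gives \<open>E\<close>; blocks \<open>1, ..., N\<close> give
    \<open>?r 0, ..., ?r (N - 1)\<close>.\<close>
  have partial: "(\<Prod>n<N * q + (q - 1). tm_factor ts a b (Suc n)) = E * (\<Prod>n<N. ?r n)" for N
  proof (induction N)
    case 0
    show ?case
      unfolding E_def tm_factor_def One_nat_def prod.atLeast1_atMost_eq
      by (simp add: add.commute)
  next
    case (Suc N)
    have "{..<Suc N * q + (q - 1)} = {..<N * q + (q - 1)} \<union> {N * q + (q - 1)..<N * q + (q - 1) + q}"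
      by auto
    then have "(\<Prod>n<Suc N * q + (q - 1). tm_factor ts a b (Suc n)) =
        (\<Prod>n<N * q + (q - 1). tm_factor ts a b (Suc n))
        * (\<Prod>n = N * q + (q - 1)..<N * q + (q - 1) + q. tm_factor ts a b (Suc n))"
      by (simp only: prod.union_disjoint[OF finite_lessThan finite_atLeastLessThan] ivl_disj_int)
    also have "(\<Prod>n = N * q + (q - 1)..<N * q + (q - 1) + q. tm_factor ts a b (Suc n))
        = (\<Prod>i<q. tm_factor ts a b (Suc N * q + i))"
      unfolding prod_atLeastLessThan_add using q(2) by (intro prod.cong) (auto simp: algebra_simps)
    also have "\<dots> = ?r N"
      unfolding A_def B_def using tm_factor_mult[OF ts(1) assms(3) q(1), of _ a b "Suc N"]
      by (intro prod.cong) auto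
    finally show ?case
      using Suc by simp
  qed
  \<comment> \<open>The block ends only give a subsequence of the partial products, which suffices
    because the whole sequence is already known to converge.\<close>
  have "filterlim (\<lambda>N. N * q + (q - 1)) sequentially sequentially"
    using q(2) by (intro filterlim_subseq strict_monoI add_strict_right_mono mult_strict_right_mono)
  then have "(\<lambda>N. \<Prod>n<N * q + (q - 1). tm_factor ts a b (Suc n)) \<longlonglongrightarrow> tm_prod ts a b"
    using has_prod_imp_tendsto'[OF has_prod[OF a b]] by (rule filterlim_compose[rotated])
  moreover have "(\<lambda>N. E * (\<Prod>n<N. ?r n)) \<longlonglongrightarrow> E * R"
    by (intro tendsto_mult tendsto_const has_prod_imp_tendsto' r)
  ultimately have eq: "tm_prod ts a b = E * R"
    unfolding partial by (rule LIMSEQ_unique)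
  \<comment> \<open>Dividing factor by factor by the blocks gives the second form; \<open>R\<close>
    is nonzero, so it cancels and leaves \<open>E\<close>.\<close>
  have "(\<lambda>n. tm_factor ts a b (Suc n) / ?r n) has_prod (tm_prod ts a b / R)"
    by (intro has_prod_divide has_prod[OF a b] r)
  then have quotient: "(\<lambda>n. tm_factor ts a b (Suc n) / ?r n) has_prod E"
    using R_nonzero eq by simp
  \<comment> \<open>Every factor of block \<open>n\<close> has exponent
    \<open>\<delta>(n) \<delta>(i)\<close>, so the common exponent \<open>\<delta>(n)\<close> can be
    pulled out of the quotient.\<close>
  have term_eq: "((of_nat n + a) / (of_nat n + b)
           * ((of_nat q * of_nat n + b) / (of_nat q * of_nat n + a))
           * (\<Prod>i = 1..q - 1.
               ((of_nat q * of_nat n + b + of_nat i) / (of_nat q * of_nat n + a + of_nat i))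
                 powi tm_sign ts i)) powi tm_sign ts n
      = tm_factor ts a b n / (\<Prod>i<q. tm_factor ts (A i) (B i) n powi tm_sign ts i)" for n
  proof -
    let ?g = "\<lambda>i. ((of_nat q * of_nat n + a + of_nat i) / (of_nat q * of_nat n + b + of_nat i) :: complex)"
    have "tm_factor ts (A i) (B i) n powi tm_sign ts i = (?g i powi tm_sign ts i) powi tm_sign ts n"
      if "i < q" for i
    proof -
      have "tm_factor ts (A i) (B i) n powi tm_sign ts i = tm_factor ts a b (n * q + i)"
        unfolding A_def B_def by (rule tm_factor_mult[OF ts(1) assms(3) q(1) that, symmetric])
      also have "\<dots> = ?g i powi (tm_sign ts i * tm_sign ts n)"
        unfolding tm_factor_def using tm_sign_mult[OF ts(1) assms(3), of i n] that q(1)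
        by (simp add: algebra_simps)
      finally show ?thesis
        by (simp add: power_int_mult)
    qed
    then have "(\<Prod>i<q. tm_factor ts (A i) (B i) n powi tm_sign ts i)
        = (\<Prod>i<q. ?g i powi tm_sign ts i) powi tm_sign ts n"
      unfolding powi_sign_distrib(2)[OF sign] by (intro prod.cong) auto
    then have "tm_factor ts a b n / (\<Prod>i<q. tm_factor ts (A i) (B i) n powi tm_sign ts i)
        = ((of_nat n + a) / (of_nat n + b) / (\<Prod>i<q. ?g i powi tm_sign ts i)) powi tm_sign ts n"
      unfolding tm_factor_def by (simp only: powi_sign_distrib(1)[OF sign])
    \<comment> \<open>Inverting \<open>?g i\<close> swaps \<open>a\<close> and \<open>b\<close>; the
      case \<open>i = 0\<close>, of sign 1, is the separate ratio in the statement.\<close>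
    also have "(of_nat n + a) / (of_nat n + b) / (\<Prod>i<q. ?g i powi tm_sign ts i)
        = (of_nat n + a) / (of_nat n + b) * inverse (?g 0)
          * (\<Prod>i = 1..q - 1. inverse (?g i) powi tm_sign ts i)"
      unfolding split_0 tm_sign_0[OF ts(1) assms(3)] power_int_inverse
        prod_inversef[of "\<lambda>i. ?g i powi tm_sign ts i", unfolded o_def]
      by (simp only: divide_inverse inverse_mult_distrib power_int_1_right mult.assoc)
    finally show ?thesis
      by simp
  qed
  have "E * R = E * tm_prod ts (a / of_nat q) (b / of_nat q)
      * (\<Prod>i = 1..q - 1. tm_prod ts (A i) (B i) powi tm_sign ts i)"
    unfolding R_def split_0 tm_sign_0[OF ts(1) assms(3)] by (simp add: A_def B_def)
  with eq have "tm_prod ts a b = E * tm_prod ts (a / of_nat q) (b / of_nat q)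
      * (\<Prod>i = 1..q - 1. tm_prod ts (A i) (B i) powi tm_sign ts i)"
    by (rule trans)
  then show ?thesis
    using convergent_tm_prod[OF ts(1) assms(3) ts(2) a b] quotient
    unfolding Let_def term_eq E_def A_def B_def by (intro conjI)
qed

end
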